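(* Let $G=(V,E)$ be any finite undirected graph without loops, $V=\{1,\dots,N\}$, let $\alpha\in[0,1]$, and let $(Z_i^t)_{i\in V,\,t\ge 0}$ be the proportions of black balls in the interacting urn process on $G$ with signal parameter $\alpha$. Then, almost surely, for every $i\in V$ the limit $\lim_{t\to\infty}Z_i^t$ exists.
   Context: Interacting urn process on $G$ with parameter $\alpha$. Let $N(i)$ be the set of neighbors of $i$ in $G$ and $d_i=|N(i)|$ its degree. Each agent $i\in V$ has an urn containing white and black balls; $B_i^t$ and $W_i^t$ are the numbers of black and white balls in urn $i$ after step $t$, $S_i^t=B_i^t+W_i^t$, and $Z_i^t=B_i^t/S_i^t$ is the proportion of black balls. Initialization ($t=0$): each agent $i$ receives a signal that is correct with probability $\alpha$ and wrong with probability $1-\alpha$; urn $i$ initially contains exactly one ball, white if the signal is correct and black if it is wrong. So $S_i^0=1$. Dynamics: at each step $t+1$ ($t\ge 0$), each agent $i$ draws one ball uniformly at random from urn $i$, with replacement. Let $X_i^{t+1}\in\{0,1\}$ be the indicator that agent $i$'s draw is black. Let $\mathcal{F}_t$ be the sigma-field generated by the initial urn contents and all the draws $X^k=(X_1^k,\dots,X_N^k)$, $1\le k\le t$. Conditionally on $\mathcal{F}_t$, the variables $X_1^{t+1},\dots,X_N^{t+1}$ are pairwise independent and $\mathbb{P}(X_i^{t+1}=1\mid\mathcal{F}_t)=Z_i^t$. Each agent then adds to his urn one ball of the drawn color for each neighbor's draw: $$B_i^{t+1}=B_i^t+\sum_{j\in N(i)}X_j^{t+1},\qquad W_i^{t+1}=W_i^t+d_i-\sum_{j\in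 N(i)}X_j^{t+1},$$ so that $S_i^t=1+d_i t$. *)

theory Defs
  imports "HOL-Probability.Probability"
begin

definition loopless_graph :: "'v set \<Rightarrow> 'v set set \<Rightarrow> bool" where
  "loopless_graph V E \<longleftrightarrow> finite V \<and> E \<subseteq> {{i, j} | i j. i \<in> V \<and> j \<in> V \<and> i \<noteq> j}"

definition neighbors :: "'v set set \<Rightarrow> 'v \<Rightarrow> 'v set" where
  "neighbors E i = {j. {i, j} \<in> E}"

abbreviation degree :: "'v set set \<Rightarrow> 'v \<Rightarrow> nat" where
  "degree E i \<equiv> card (neighbors E i)"

lemma finite_neighbors:
  assumes "loopless_graph V E"
  shows "finite (neighbors E i)"
proof (rule finite_subset)
  show "neighbors E i \<subseteq> V"
    using assms by (fastforce simp: loopless_graph_def neighbors_def doubleton_eq_iff)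
  show "finite V" using assms by (simp add: loopless_graph_def)
qed

(* The urns are driven by the events correct i (the signal of agent i is correct) and X t i
   (the ball drawn by agent i at step t is black; only t >= 1 is ever used).
   The subtraction in white never truncates, see urn_total. *)

fun black :: "'v set set \<Rightarrow> ('v \<Rightarrow> 'a \<Rightarrow> bool) \<Rightarrow> (nat \<Rightarrow> 'v \<Rightarrow> 'a \<Rightarrow> bool) \<Rightarrow> nat \<Rightarrow> 'v \<Rightarrow> 'a \<Rightarrow> nat" where
  "black E correct X 0 i \<omega> = of_bool (\<not> correct i \<omega>)"
| "black E correct X (Suc t) i \<omega> =
     black E correct X t i \<omega> + (\<Sum>j\<in>neighbors E i. of_bool (X (Suc t) j \<omega>))"

fun white :: "'v set set \<Rightarrow> ('v \<Rightarrow> 'a \<Rightarrow> bool) \<Rightarrow> (nat \<Rightarrow> 'v \<Rightarrow> 'a \<Rightarrow> bool) \<Rightarrow> nat \<Rightarrow> 'v \<Rightarrow> 'a \<Rightarrow> nat" where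
  "white E correct X 0 i \<omega> = of_bool (correct i \<omega>)"
| "white E correct X (Suc t) i \<omega> =
     white E correct X t i \<omega> + (degree E i - (\<Sum>j\<in>neighbors E i. of_bool (X (Suc t) j \<omega>)))"

definition black_proportion ::
    "'v set set \<Rightarrow> ('v \<Rightarrow> 'a \<Rightarrow> bool) \<Rightarrow> (nat \<Rightarrow> 'v \<Rightarrow> 'a \<Rightarrow> bool) \<Rightarrow> nat \<Rightarrow> 'v \<Rightarrow> 'a \<Rightarrow> real" where
  "black_proportion E correct X t i \<omega> =
     real (black E correct X t i \<omega>) / real (black E correct X t i \<omega> + white E correct X t i \<omega>)"

lemma urn_total:
  "black E correct X t i \<omega> + white E correct X t i \<omega> = 1 + degree E i * t"
proof (induction t)
  case (Suc t)
  have "(\<Sum>j\<in>neighbors E i. of_bool (X (Suc t) j \<omega>)) \<le> (\<Sum>j\<in>neighbors E i. 1::nat)"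
    by (rule sum_mono) simp
  then show ?case using Suc by simp
qed simp

definition urn_filtration ::
    "'a measure \<Rightarrow> 'v set \<Rightarrow> 'v set set \<Rightarrow> ('v \<Rightarrow> 'a \<Rightarrow> bool) \<Rightarrow> (nat \<Rightarrow> 'v \<Rightarrow> 'a \<Rightarrow> bool) \<Rightarrow> nat \<Rightarrow> 'a measure" where
  "urn_filtration M V E correct X t = sigma (space M)
     ({{\<omega> \<in> space M. black E correct X 0 i \<omega> = n} | i n. i \<in> V} \<union>
      {{\<omega> \<in> space M. white E correct X 0 i \<omega> = n} | i n. i \<in> V} \<union>
      {{\<omega> \<in> space M. X k i \<omega>} | k i. i \<in> V \<and> 1 \<le> k \<and> k \<le> t})"

definition cond_indep_var ::
    "'a measure \<Rightarrow> 'a measure \<Rightarrow> 'b measure \<Rightarrow> ('a \<Rightarrow> 'b) \<Rightarrow> 'c measure \<Rightarrow> ('a \<Rightarrow> 'c) \<Rightarrow> bool" where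
  "cond_indep_var M F S X T Y \<longleftrightarrow> X \<in> measurable M S \<and> Y \<in> measurable M T \<and>
     (\<forall>A\<in>sets S. \<forall>B\<in>sets T. AE \<omega> in M.
        real_cond_exp M F (indicator {\<omega> \<in> space M. X \<omega> \<in> A \<and> Y \<omega> \<in> B}) \<omega> =
        real_cond_exp M F (indicator {\<omega> \<in> space M. X \<omega> \<in> A}) \<omega> *
        real_cond_exp M F (indicator {\<omega> \<in> space M. Y \<omega> \<in> B}) \<omega>)"

(* No joint independence of the signals is assumed, only their marginal law. *)

locale interacting_urn_process = prob_space M
  for M :: "'a measure" +
  fixes V :: "'v set" and E :: "'v set set" and \<alpha> :: real
    and correct :: "'v \<Rightarrow> 'a \<Rightarrow> bool" and X :: "nat \<Rightarrow> 'v \<Rightarrow> 'a \<Rightarrow> bool"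
  assumes measurable_correct: "i \<in> V \<Longrightarrow> correct i \<in> measurable M (count_space UNIV)"
    and measurable_draw: "i \<in> V \<Longrightarrow> X (Suc t) i \<in> measurable M (count_space UNIV)"
    and prob_correct: "i \<in> V \<Longrightarrow> prob {\<omega> \<in> space M. correct i \<omega>} = \<alpha>"
    and prob_draw: "i \<in> V \<Longrightarrow> AE \<omega> in M.
      real_cond_exp M (urn_filtration M V E correct X t) (indicator {\<omega> \<in> space M. X (Suc t) i \<omega>}) \<omega> =
      black_proportion E correct X t i \<omega>"
    and indep_draws: "i \<in> V \<Longrightarrow> j \<in> V \<Longrightarrow> i \<noteq> j \<Longrightarrow>
      cond_indep_var M (urn_filtration M V E correct X t)
        (count_space UNIV) (X (Suc t) i) (count_space UNIV) (X (Suc t) j)"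

end

theory Submission
  imports Defs "HOL-Real_Asymp.Real_Asymp" "HOL-Library.Discrete_Functions"
begin

text \<open>
  Write $\xi_j^{t+1} = X_j^{t+1} - Z_j^t$. These martingale differences are bounded and orthogonal, so
  $\sum_t \xi_j^{t+1}/(t+1)$ converges almost surely. What remains is pathwise:
  $d_i (Z_i^{t+1} - Z_i^t) = \frac{1}{t+1} \sum_{j \in N(i)} (Z_j^t - Z_i^t) + \varepsilon_i^t$ with
  $\sum_t \varepsilon_i^t$ convergent. Adding the tail $\sum_{s \ge t} \varepsilon_i^s / d_i$ to $Z_i^t$ gives a
  perturbation of the heat flow by an $o(1/t)$ term that preserves the degree-weighted mean of each connected
  component exactly. By a Poincare inequality the degree-weighted variance $Q$ on a component satisfies
  $Q_{t+1} \le (1 - c/(t+1)) Q_t + o(1)/(t+1)$, hence tends to $0$, and all $Z_i$ of a component converge to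
  the same limit.
\<close>

subsection \<open>Real sequences and orthogonal series\<close>

text \<open>Once \<open>\<delta> t\<close> stays below \<open>c * e\<close>, each step multiplies
  the excess of \<open>u\<close> over \<open>e\<close> by at most \<open>1 - c / Suc t\<close>.
  Since the harmonic series diverges, the product of these factors decays like
  \<open>t powr - c\<close>, so the excess tends to 0 for every positive \<open>e\<close>.\<close>

lemma contraction_tendsto_zero:
  fixes u \<delta> :: "nat \<Rightarrow> real"
  assumes "0 < c" and nonneg: "\<And>t. 0 \<le> u t" and \<delta>: "\<delta> \<longlonglongrightarrow> 0"
    and step: "\<And>t. u (Suc t) \<le> (1 - c / Suc t) * u t + \<delta> t / Suc t"
  shows "u \<longlonglongrightarrow> 0"
proof (rule LIMSEQ_I)
    fix r :: real assume "0 < r"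
    define e where "e = r / 2"
    have e: "0 < e" using \<open>0 < r\<close> by (simp add: e_def)
    have "\<forall>\<^sub>F t in sequentially. \<delta> t < c * e"
      using order_tendstoD(2)[OF \<delta>, of "c * e"] \<open>0 < c\<close> e by simp
    moreover have "\<forall>\<^sub>F t in sequentially. c / real (Suc t) < 1"
      by (rule order_tendstoD(2)[of _ 0]) (real_asymp, simp)
    ultimately have "\<forall>\<^sub>F t in sequentially. \<delta> t < c * e \<and> c / real (Suc t) < 1"
      by (rule eventually_conj)
    then obtain T where T: "\<And>t. T \<le> t \<Longrightarrow> \<delta> t < c * e" "\<And>t. T \<le> t \<Longrightarrow> c / real (Suc t) < 1"
      unfolding eventually_sequentially by blast
    \<comment> \<open>Passing to the excess over \<open>e\<close> makes the recursion homogeneous: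
      the perturbation is at most \<open>c * e / Suc t\<close>, which is exactly what the
      contraction takes away from \<open>e\<close> itself.\<close>
    define v where "v t = max 0 (u t - e)" for t
    have v_nonneg: "0 \<le> v t" for t by (simp add: v_def)
    \<comment> \<open>The inequalities \<open>1 - x \<le> exp (- x)\<close> and
      \<open>ln (1 + x) \<le> x\<close> bound the contraction factor by the ratio of consecutive
      values of \<open>powr c\<close>, so this product does not increase from \<open>T\<close>
      on.\<close>
    have dec: "v (Suc t) * real (Suc (Suc t)) powr c \<le> v t * real (Suc t) powr c" if "T \<le> t" for t
    proof -
      have a: "0 \<le> 1 - c / real (Suc t)" using T(2)[OF that] by simp
      have "u (Suc t) - e \<le> (1 - c / Suc t) * u t + c * e / Suc t - e"
        using step[of t] divide_right_mono[OF less_imp_le[OF T(1)[OF that]], of "real (Suc t)"] by linarith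
      also have "\<dots> = (1 - c / Suc t) * (u t - e)"
        by (simp add: left_diff_distrib right_diff_distrib diff_divide_distrib)
      also have "\<dots> \<le> (1 - c / Suc t) * v t"
        using a by (intro mult_left_mono) (auto simp: v_def)
      finally have v: "v (Suc t) \<le> (1 - c / Suc t) * v t"
        using a v_nonneg[of t] unfolding v_def by simp
      have "ln (1 + 1 / real (Suc t)) \<le> 1 / real (Suc t)"
        by (rule ln_add_one_self_le_self) simp
      moreover have "1 + 1 / real (Suc t) = real (Suc (Suc t)) / real (Suc t)" by (simp add: field_simps)
      ultimately have ln: "ln (real (Suc (Suc t))) - ln (real (Suc t)) \<le> 1 / real (Suc t)"
        by (simp add: ln_div)
      have "1 - c / real (Suc t) \<le> exp (- c / real (Suc t))"
        using exp_ge_add_one_self[of "- c / real (Suc t)"] by simp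
      also have "\<dots> \<le> exp (c * (ln (real (Suc t)) - ln (real (Suc (Suc t)))))"
        using mult_left_mono[OF ln, of c] \<open>0 < c\<close> by (simp add: algebra_simps)
      also have "\<dots> = real (Suc t) powr c / real (Suc (Suc t)) powr c"
        by (simp add: powr_def exp_diff[symmetric] algebra_simps)
      finally have "(1 - c / real (Suc t)) * real (Suc (Suc t)) powr c \<le> real (Suc t) powr c"
        by (simp add: pos_le_divide_eq)
      then have *: "v t * ((1 - c / real (Suc t)) * real (Suc (Suc t)) powr c) \<le> v t * real (Suc t) powr c"
        by (rule mult_left_mono) (rule v_nonneg)
      have "v (Suc t) * real (Suc (Suc t)) powr c
          \<le> (1 - c / Suc t) * v t * real (Suc (Suc t)) powr c"
        by (rule mult_right_mono[OF v]) simp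
      also have "\<dots> = v t * ((1 - c / real (Suc t)) * real (Suc (Suc t)) powr c)"
        by (simp only: mult_ac)
      finally show ?thesis using * by (rule order_trans)
    qed
    define L where "L = v T * real (Suc T) powr c"
    have L: "v t * real (Suc t) powr c \<le> L" if "T \<le> t" for t
      using that
    proof (induction t rule: dec_induct)
      case (step n)
      then show ?case using dec[of n] by linarith
    qed (simp add: L_def)
    have "(\<lambda>t. L * real (Suc t) powr - c) \<longlonglongrightarrow> 0" using \<open>0 < c\<close> by real_asymp
    then have "\<forall>\<^sub>F t in sequentially. L * real (Suc t) powr - c < e"
      using e by (rule order_tendstoD(2))
    then obtain T' where T': "\<And>t. T' \<le> t \<Longrightarrow> L * real (Suc t) powr - c < e"
      unfolding eventually_sequentially by blast
    show "\<exists>no. \<forall>n\<ge>no. norm (u n - 0) < r"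
    proof (intro exI allI impI)
      fix n assume n: "max T T' \<le> n"
      have "v n \<le> L * real (Suc n) powr - c"
        using L[of n] n by (simp add: powr_minus field_simps)
      then have "u n - e < e" using T'[of n] n unfolding v_def by simp
      then show "norm (u n - 0) < r" using nonneg[of n] by (simp add: e_def)
    qed
qed

text \<open>With \<open>k = floor_sqrt n\<close>, at most \<open>2 * k\<close> steps of size at most
  \<open>1 / Suc (k\<^sup>2)\<close> lead from \<open>k\<^sup>2\<close> to \<open>n\<close>. Hence
  \<open>T n\<close> differs from \<open>T (k\<^sup>2)\<close> by O(1/k) and inherits its
  limit.\<close>

lemma convergent_if_convergent_on_squares:
  fixes T :: "nat \<Rightarrow> real"
  assumes squares: "convergent (\<lambda>k. T (k\<^sup>2))"
    and step: "\<And>n. \<bar>T (Suc n) - T n\<bar> \<le> 1 / Suc n"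
  shows "convergent T"
proof -
  obtain L where L: "(\<lambda>k. T (k\<^sup>2)) \<longlonglongrightarrow> L" using squares by (auto simp: convergent_def)
  have sqrt_top: "filterlim floor_sqrt at_top sequentially"
    unfolding filterlim_at_top
  proof
    fix Z :: nat
    show "\<forall>\<^sub>F n in sequentially. Z \<le> floor_sqrt n"
      using eventually_ge_at_top[of "Z\<^sup>2"] by eventually_elim (simp add: le_floor_sqrt_iff)
  qed
  have gap: "\<bar>T (a + n) - T a\<bar> \<le> real n / Suc a" for a n
  proof (induction n)
    case (Suc n)
    have "1 / real (Suc (a + n)) \<le> 1 / Suc a" by (simp add: field_simps)
    then show ?case using Suc step[of "a + n"] by (simp add: add_divide_distrib)
  qed simp
  have bound: "\<bar>T n - T ((floor_sqrt n)\<^sup>2)\<bar> \<le> 2 * real (floor_sqrt n) / Suc ((floor_sqrt n)\<^sup>2)" for n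
  proof -
    have "\<bar>T n - T ((floor_sqrt n)\<^sup>2)\<bar> \<le> real (n - (floor_sqrt n)\<^sup>2) / Suc ((floor_sqrt n)\<^sup>2)"
      using gap[of "(floor_sqrt n)\<^sup>2" "n - (floor_sqrt n)\<^sup>2"] by simp
    also have "n - (floor_sqrt n)\<^sup>2 \<le> 2 * floor_sqrt n"
      using Suc_floor_sqrt_power2_gt[of n] by (simp add: power2_eq_square)
    then have "real (n - (floor_sqrt n)\<^sup>2) \<le> 2 * real (floor_sqrt n)" by linarith
    then have "real (n - (floor_sqrt n)\<^sup>2) / Suc ((floor_sqrt n)\<^sup>2) \<le> 2 * real (floor_sqrt n) / Suc ((floor_sqrt n)\<^sup>2)"
      by (rule divide_right_mono) simp
    finally show ?thesis .
  qed
  have "(\<lambda>k. 2 * real k / Suc (k\<^sup>2)) \<longlonglongrightarrow> 0" by real_asymp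
  from filterlim_compose[OF this sqrt_top]
  have "(\<lambda>n. T n - T ((floor_sqrt n)\<^sup>2)) \<longlonglongrightarrow> 0"
    by (rule Lim_null_comparison[rotated]) (use bound in simp)
  from tendsto_add[OF this filterlim_compose[OF L sqrt_top]]
  have "T \<longlonglongrightarrow> L" by simp
  then show ?thesis by (auto simp: convergent_def)
qed

text \<open>
  Along the squares the increments $D_k$ of the partial sums satisfy $E[D_k^2] = O(k^{-3})$, so
  $\sum_k E|D_k| < \infty$; between consecutive squares the sum changes by at most $O(1/k)$
  deterministically.
\<close>

lemma orthogonal_bounded_series_convergent:
  fixes \<xi> :: "nat \<Rightarrow> 'a \<Rightarrow> real"
  assumes "prob_space M"
    and meas [measurable]: "\<And>n. \<xi> n \<in> borel_measurable M"
    and bound: "\<And>n \<omega>. \<bar>\<xi> n \<omega>\<bar> \<le> 1"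
    and orth: "\<And>m n. m < n \<Longrightarrow> (\<integral>\<omega>. \<xi> m \<omega> * \<xi> n \<omega> \<partial>M) = 0"
  shows "AE \<omega> in M. summable (\<lambda>n. \<xi> n \<omega> / real (Suc n))"
proof -
  interpret prob_space M by fact
  define T where "T n \<omega> = (\<Sum>k<n. \<xi> k \<omega> / real (Suc k))" for n \<omega>
  have T_meas [measurable]: "T n \<in> borel_measurable M" for n
    unfolding T_def by measurable
  define D where "D k \<omega> = T ((Suc k)\<^sup>2) \<omega> - T (k\<^sup>2) \<omega>" for k \<omega>
  have sq_less: "k\<^sup>2 \<le> (Suc k)\<^sup>2" for k :: nat by (simp add: power2_eq_square)
  have T_diff: "T b \<omega> - T a \<omega> = (\<Sum>n\<in>{a..<b}. \<xi> n \<omega> / real (Suc n))" if "a \<le> b" for a b \<omega>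
    using sum_diff_nat_ivl[of 0 a b "\<lambda>n. \<xi> n \<omega> / real (Suc n)"] that
    by (simp add: T_def atLeast0LessThan)
  have int_prod: "integrable M (\<lambda>\<omega>. \<xi> m \<omega> * \<xi> n \<omega>)" for m n
    by (rule integrable_const_bound[where B = 1])
       (auto simp: abs_mult intro!: mult_le_one bound)
  have D_meas [measurable]: "D k \<in> borel_measurable M" for k
    unfolding D_def by measurable
  have D_bound: "\<bar>D k \<omega>\<bar> \<le> 2 * real k + 1" for k \<omega>
  proof -
    have "\<bar>D k \<omega>\<bar> \<le> (\<Sum>n\<in>{k\<^sup>2..<(Suc k)\<^sup>2}. \<bar>\<xi> n \<omega> / real (Suc n)\<bar>)"
      unfolding D_def T_diff[OF sq_less] by (rule sum_abs)
    also have "\<dots> \<le> (\<Sum>n\<in>{k\<^sup>2..<(Suc k)\<^sup>2}. 1)"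
    proof (rule sum_mono)
      fix n
      show "\<bar>\<xi> n \<omega> / real (Suc n)\<bar> \<le> 1" using bound[of n \<omega>] by (simp add: divide_simps)
    qed
    also have "\<dots> = 2 * real k + 1" by (simp add: power2_eq_square algebra_simps)
    finally show ?thesis .
  qed
  have int_D: "integrable M (D k)" for k
    by (rule integrable_const_bound[where B = "2 * real k + 1"]) (auto simp: D_bound)
  have int_D2: "integrable M (\<lambda>\<omega>. (D k \<omega>)\<^sup>2)" for k
  proof (rule integrable_const_bound[where B = "(2 * real k + 1)\<^sup>2"])
    show "AE \<omega> in M. norm ((D k \<omega>)\<^sup>2) \<le> (2 * real k + 1)\<^sup>2"
      using D_bound[of k] by (auto intro!: AE_I2 simp: abs_le_square_iff[symmetric])
  qed simp
  \<comment> \<open>Orthogonality leaves only the \<open>2 * k + 1\<close> diagonal terms of the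
    squared block sum. Each is at most \<open>1 / k ^ 4\<close>, because \<open>Suc m\<close>
    exceeds \<open>k\<^sup>2\<close> throughout the block.\<close>
  have D2: "expectation (\<lambda>\<omega>. (D k \<omega>)\<^sup>2) \<le> 3 / real k ^ 3" if "1 \<le> k" for k
  proof -
    let ?I = "{k\<^sup>2..<(Suc k)\<^sup>2}"
    have "expectation (\<lambda>\<omega>. (D k \<omega>)\<^sup>2)
        = expectation (\<lambda>\<omega>. \<Sum>m\<in>?I. \<Sum>n\<in>?I. (\<xi> m \<omega> * \<xi> n \<omega>) / (real (Suc m) * real (Suc n)))"
      unfolding D_def T_diff[OF sq_less] power2_eq_square[of "sum _ _"] sum_product by simp
    also have "\<dots> = (\<Sum>m\<in>?I. \<Sum>n\<in>?I. expectation (\<lambda>\<omega>. \<xi> m \<omega> * \<xi> n \<omega>) / (real (Suc m) * real (Suc n)))"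
      using int_prod by (simp add: Bochner_Integration.integral_sum)
    also have "\<dots> \<le> (\<Sum>m\<in>?I. \<Sum>n\<in>?I. if m = n then 1 / (real k)^4 else 0)"
    proof (intro sum_mono)
      fix m n assume m: "m \<in> ?I" and n: "n \<in> ?I"
      show "expectation (\<lambda>\<omega>. \<xi> m \<omega> * \<xi> n \<omega>) / (real (Suc m) * real (Suc n)) \<le> (if m = n then 1 / (real k)^4 else 0)"
      proof (cases "m = n")
        case True
        have "expectation (\<lambda>\<omega>. \<xi> m \<omega> * \<xi> n \<omega>) \<le> expectation (\<lambda>_. 1)"
        proof (rule integral_mono[OF int_prod])
          fix \<omega> show "\<xi> m \<omega> * \<xi> n \<omega> \<le> 1"
            using bound[of m \<omega>] True abs_le_square_iff[of "\<xi> m \<omega>" 1] by (simp add: power2_eq_square)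
        qed simp
        then have "expectation (\<lambda>\<omega>. \<xi> m \<omega> * \<xi> n \<omega>) \<le> 1" by (simp add: prob_space)
        moreover have "(real k)^4 \<le> real (Suc m) * real (Suc n)"
        proof -
          have "(real k)\<^sup>2 \<le> real m" using m by (metis atLeastLessThan_iff of_nat_le_iff of_nat_power)
          then have "(real k)\<^sup>2 * (real k)\<^sup>2 \<le> real (Suc m) * real (Suc m)"
            by (intro mult_mono) (linarith | simp)+
          then show ?thesis using True by (simp add: power2_eq_square power4_eq_xxxx mult_ac)
        qed
        ultimately have "expectation (\<lambda>\<omega>. \<xi> m \<omega> * \<xi> n \<omega>) / (real (Suc m) * real (Suc n)) \<le> 1 / (real k)^4"
          using that by (intro frac_le) auto
        then show ?thesis using True by simp
      next
        case False
        then have "expectation (\<lambda>\<omega>. \<xi> m \<omega> * \<xi> n \<omega>) = 0"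
          using orth[of m n] orth[of n m] by (cases "m < n") (auto simp: mult.commute)
        then show ?thesis using False by simp
      qed
    qed
    also have "\<dots> = (\<Sum>m\<in>?I. 1 / (real k)^4)"
      by (intro sum.cong refl) simp
    also have "\<dots> = (2 * real k + 1) / real k ^ 4"
      by (simp add: power2_eq_square algebra_simps)
    also have "\<dots> \<le> 3 / real k ^ 3"
      using that by (simp add: field_simps eval_nat_numeral)
    finally show ?thesis .
  qed
  \<comment> \<open>A weighted arithmetic-geometric mean inequality replaces Cauchy-Schwarz. The
    weight \<open>k powr (3/2)\<close> balances the two terms, so that both are of order
    \<open>k powr (-3/2)\<close>, which is summable.\<close>
  have D1: "expectation (\<lambda>\<omega>. \<bar>D k \<omega>\<bar>) \<le> 2 * real k powr (-3/2)" if "1 \<le> k" for k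
  proof -
    let ?q = "real k powr (3/2)"
    have q: "0 < ?q" "?q * ?q = real k ^ 3" "inverse ?q = real k powr (-3/2)"
    proof -
      show "0 < ?q" using that by simp
      have "?q * ?q = real k powr (3/2 + 3/2)" by (simp only: powr_add)
      also have "\<dots> = real k powr real 3" by simp
      also have "\<dots> = real k ^ 3" using that by (intro powr_realpow) simp
      finally show "?q * ?q = real k ^ 3" .
      show "inverse ?q = real k powr (-3/2)" using powr_minus[of "real k" "3/2"] by simp
    qed
    have "\<bar>D k \<omega>\<bar> \<le> (?q * (D k \<omega>)\<^sup>2 + inverse ?q) / 2" for \<omega>
    proof -
      have "0 \<le> (?q * \<bar>D k \<omega>\<bar> - 1)\<^sup>2" by simp
      also have "\<dots> = ?q * (?q * (D k \<omega>)\<^sup>2 + inverse ?q - 2 * \<bar>D k \<omega>\<bar>)"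
        using q(1) by (simp add: power2_eq_square algebra_simps flip: abs_mult)
      finally show ?thesis using q(1) by (simp add: zero_le_mult_iff)
    qed
    then have "expectation (\<lambda>\<omega>. \<bar>D k \<omega>\<bar>) \<le> expectation (\<lambda>\<omega>. (?q * (D k \<omega>)\<^sup>2 + inverse ?q) / 2)"
      by (intro integral_mono) (use int_D int_D2 in auto)
    also have "\<dots> = (?q * expectation (\<lambda>\<omega>. (D k \<omega>)\<^sup>2) + inverse ?q) / 2"
      using int_D2 by (simp add: prob_space)
    also have "\<dots> \<le> (?q * (3 / real k ^ 3) + inverse ?q) / 2"
      using D2[OF that] q(1) by (intro divide_right_mono add_right_mono mult_left_mono) auto
    also have "?q * (3 / real k ^ 3) = 3 * inverse ?q"
      using q(1) by (simp add: q(2)[symmetric] field_simps)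
    finally show ?thesis by (simp add: q(3))
  qed
  \<comment> \<open>Sum and expectation may be exchanged because all terms are nonnegative. The
    block with index 0 is left out since the bound \<open>D1\<close> starts at 1; it does not affect
    summability.\<close>
  have nn_fin: "(\<integral>\<^sup>+\<omega>. (\<Sum>k. ennreal \<bar>D (Suc k) \<omega>\<bar>) \<partial>M) \<noteq> \<infinity>"
  proof -
    have sm: "summable (\<lambda>k. 2 * real (Suc k) powr (-3/2))"
      using summable_real_powr_iff[of "-3/2"] by (subst summable_Suc_iff) (intro summable_mult, simp)
    have "(\<integral>\<^sup>+\<omega>. (\<Sum>k. ennreal \<bar>D (Suc k) \<omega>\<bar>) \<partial>M) = (\<Sum>k. \<integral>\<^sup>+\<omega>. ennreal \<bar>D (Suc k) \<omega>\<bar> \<partial>M)"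
      by (rule nn_integral_suminf) simp
    also have "\<dots> = (\<Sum>k. ennreal (expectation (\<lambda>\<omega>. \<bar>D (Suc k) \<omega>\<bar>)))"
      by (subst nn_integral_eq_integral) (use int_D in auto)
    also have "\<dots> \<le> (\<Sum>k. ennreal (2 * real (Suc k) powr (-3/2)))"
      by (intro suminf_le ennreal_leI D1) auto
    also have "\<dots> = ennreal (\<Sum>k. 2 * real (Suc k) powr (-3/2))"
      by (rule suminf_ennreal2[OF _ sm]) simp
    finally show ?thesis by (auto simp: top_unique)
  qed
  have "AE \<omega> in M. (\<Sum>k. ennreal \<bar>D (Suc k) \<omega>\<bar>) \<noteq> \<infinity>"
    by (rule nn_integral_PInf_AE[OF _ nn_fin]) simp
  then show ?thesis
  proof eventually_elim
    case (elim \<omega>)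
    then have "summable (\<lambda>k. \<bar>D (Suc k) \<omega>\<bar>)"
      by (intro summable_suminf_not_top) auto
    then have "summable (\<lambda>k. D k \<omega>)"
      by (subst summable_Suc_iff[symmetric]) (rule summable_rabs_cancel)
    then have "convergent (\<lambda>n. \<Sum>k<n. D k \<omega>)"
      by (simp add: summable_iff_convergent)
    moreover have "(\<Sum>k<n. D k \<omega>) = T (n\<^sup>2) \<omega>" for n
      unfolding D_def by (subst sum_lessThan_telescope) (simp add: T_def)
    ultimately have "convergent (\<lambda>n. T (n\<^sup>2) \<omega>)" by simp
    then have "convergent (\<lambda>n. T n \<omega>)"
      by (rule convergent_if_convergent_on_squares)
         (use bound in \<open>simp add: T_def divide_right_mono\<close>)
    then show ?case by (simp add: summable_iff_convergent T_def)
  qed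
qed

subsection \<open>Perturbed heat flow on a weighted network\<close>

text \<open>The square is expanded around \<open>x\<close> and sorted for the energy estimate, where
  \<open>T\<close> is \<open>Suc t\<close>: every increment carries a factor \<open>1 / T\<close>,
  and the quadratic one a second such factor that makes it o(1) relative to the first.\<close>

lemma weighted_square_step:
  fixes a T :: real
  assumes "0 < a" and step: "a * (x' - x) = (f + h) / T"
  shows "a * x'\<^sup>2 = a * x\<^sup>2 + (2 * (x * f)) / T + (2 * (x * h)) / T + (f + h)\<^sup>2 / a * (1 / T) / T"
proof -
  have "a * x'\<^sup>2 = a * x\<^sup>2 + 2 * x * (a * (x' - x)) + (a * (x' - x))\<^sup>2 / a"
  proof -
    have "(a * (x' - x))\<^sup>2 / a = a * (x' - x)\<^sup>2"
      using \<open>0 < a\<close> by (simp add: power2_eq_square)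
    then show ?thesis by (simp add: power2_eq_square algebra_simps)
  qed
  also have "\<dots> = a * x\<^sup>2 + 2 * x * ((f + h) / T) + ((f + h) / T)\<^sup>2 / a"
    by (simp only: step)
  also have "2 * x * ((f + h) / T) = (2 * (x * f)) / T + (2 * (x * h)) / T"
    by (simp add: add_divide_distrib distrib_left)
  also have "((f + h) / T)\<^sup>2 / a = (f + h)\<^sup>2 / a * (1 / T) / T"
    by (simp add: power_divide power2_eq_square)
  finally show ?thesis by simp
qed

text \<open>Symmetric conductances on a connected graph. Positive total weight permits division by
  the degree; isolated agents of the urn process therefore have to be treated separately.\<close>

locale weighted_network =
  fixes C :: "'v set" and w :: "'v \<Rightarrow> 'v \<Rightarrow> real"
  assumes finite_vertices: "finite C"
    and weight_sym: "\<And>i j. i \<in> C \<Longrightarrow> j \<in> C \<Longrightarrow> w i j = w j i"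
    and weight_nonneg: "\<And>i j. 0 \<le> w i j"
    and total_weight_pos: "\<And>i. i \<in> C \<Longrightarrow> 0 < (\<Sum>j\<in>C. w i j)"
    and connected: "\<And>i j. i \<in> C \<Longrightarrow> j \<in> C \<Longrightarrow> (i, j) \<in> {(i, j). i \<in> C \<and> j \<in> C \<and> 0 < w i j}\<^sup>*"
begin

section \<open>Graph Laplacian, Dirichlet form and Poincare inequality\<close>

definition deg :: "'v \<Rightarrow> real" where
  "deg i = (\<Sum>j\<in>C. w i j)"

text \<open>This is the negated combinatorial Laplacian of the weighted graph.\<close>

definition flow :: "('v \<Rightarrow> real) \<Rightarrow> 'v \<Rightarrow> real" where
  "flow x i = (\<Sum>j\<in>C. w i j * (x j - x i))"

definition energy :: "('v \<Rightarrow> real) \<Rightarrow> real" where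
  "energy x = (\<Sum>i\<in>C. deg i * (x i)\<^sup>2)"

text \<open>The sum runs over ordered pairs, so this is twice the usual Dirichlet form.\<close>

definition dirichlet :: "('v \<Rightarrow> real) \<Rightarrow> real" where
  "dirichlet x = (\<Sum>i\<in>C. \<Sum>j\<in>C. w i j * (x i - x j)\<^sup>2)"

lemma deg_pos: "i \<in> C \<Longrightarrow> 0 < deg i"
  by (simp add: deg_def total_weight_pos)

text \<open>Summation by parts: exchanging the names \<open>i\<close> and \<open>j\<close> and using
  the symmetry of \<open>w\<close> gives a second expression for the same sum, and adding both
  produces the product of differences.\<close>

lemma green: "2 * (\<Sum>i\<in>C. u i * flow x i) = - (\<Sum>i\<in>C. \<Sum>j\<in>C. w i j * ((u i - u j) * (x i - x j)))"
proof -
  have A: "(\<Sum>i\<in>C. u i * flow x i) = (\<Sum>i\<in>C. \<Sum>j\<in>C. w i j * (u i * (x j - x i)))"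
    by (simp add: flow_def sum_distrib_left mult_ac)
  also have "\<dots> = (\<Sum>i\<in>C. \<Sum>j\<in>C. w i j * (u j * (x i - x j)))"
    by (subst sum.swap) (intro sum.cong refl, simp add: weight_sym)
  finally have B: "(\<Sum>i\<in>C. u i * flow x i) = \<dots>" .
  have "2 * (\<Sum>i\<in>C. u i * flow x i)
      = (\<Sum>i\<in>C. \<Sum>j\<in>C. w i j * (u i * (x j - x i)) + w i j * (u j * (x i - x j)))"
    using A B by (simp add: sum.distrib)
  also have "\<dots> = - (\<Sum>i\<in>C. \<Sum>j\<in>C. w i j * ((u i - u j) * (x i - x j)))"
    unfolding sum_negf[symmetric] by (intro sum.cong refl) (simp add: algebra_simps)
  finally show ?thesis .
qed

text \<open>Conservation of mass under the heat flow; this is what keeps the degree-weighted mean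
  constant in the dynamics below.\<close>

lemma sum_flow: "(\<Sum>i\<in>C. flow x i) = 0"
  using green[of "\<lambda>_. 1" x] by simp

lemma sum_mult_flow: "2 * (\<Sum>i\<in>C. x i * flow x i) = - dirichlet x"
  using green[of x x] by (simp add: dirichlet_def power2_eq_square)

lemma flow_add: "flow (\<lambda>i. x i + y i) i = flow x i + flow y i"
  by (simp add: flow_def sum.distrib[symmetric] algebra_simps)

lemma flow_diff_const: "flow (\<lambda>i. x i - m) i = flow x i"
  by (simp add: flow_def)

lemma dirichlet_nonneg: "0 \<le> dirichlet x"
  unfolding dirichlet_def by (intro sum_nonneg mult_nonneg_nonneg weight_nonneg) auto

text \<open>Induction along a path from \<open>i\<close> to \<open>j\<close>: the squared difference
  over one edge is at most \<open>dirichlet x\<close> divided by its weight, and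
  \<open>(a + b)^2 \<le> 2 * a^2 + 2 * b^2\<close> joins the edges. The constant depends on the path
  but not on \<open>x\<close>.\<close>

lemma square_diff_le_dirichlet:
  assumes "i \<in> C" "j \<in> C"
  shows "\<exists>K\<ge>0. \<forall>x. (x i - x j)\<^sup>2 \<le> K * dirichlet x"
  using connected[OF assms]
proof (induction rule: rtrancl_induct)
  case base
  then show ?case by (intro exI[of _ 0]) simp
next
  case (step j k)
  then obtain K where K: "0 \<le> K" "\<And>x. (x i - x j)\<^sup>2 \<le> K * dirichlet x" by blast
  have jk: "j \<in> C" "k \<in> C" "0 < w j k" using step by auto
  have edge: "(x j - x k)\<^sup>2 \<le> dirichlet x / w j k" for x
  proof -
    have "w j k * (x j - x k)\<^sup>2 \<le> (\<Sum>k\<in>C. w j k * (x j - x k)\<^sup>2)"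
      using jk finite_vertices by (intro member_le_sum mult_nonneg_nonneg weight_nonneg) auto
    also have "\<dots> \<le> dirichlet x"
      unfolding dirichlet_def using jk finite_vertices
      by (intro member_le_sum[of j C "\<lambda>j. \<Sum>k\<in>C. w j k * (x j - x k)\<^sup>2"]
          sum_nonneg mult_nonneg_nonneg weight_nonneg) auto
    finally show ?thesis using jk by (simp add: field_simps)
  qed
  have "(x i - x k)\<^sup>2 \<le> (2 * K + 2 / w j k) * dirichlet x" for x
  proof -
    have "0 \<le> ((x i - x j) - (x j - x k))\<^sup>2" by simp
    then have "(x i - x k)\<^sup>2 \<le> 2 * (x i - x j)\<^sup>2 + 2 * (x j - x k)\<^sup>2"
      by (simp add: power2_eq_square algebra_simps)
    then show ?thesis using K(2)[of x] edge[of x] by (simp add: algebra_simps)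
  qed
  then show ?case using K(1) jk(3) by (intro exI[of _ "2 * K + 2 / w j k"]) auto
qed

text \<open>For centered \<open>x\<close> the mixed terms of the sum of
  \<open>deg i * deg j * (x i - x j)\<^sup>2\<close> cancel, and the sum equals
  \<open>2 * S * energy x\<close> with \<open>S\<close> the total degree. Bounding every summand by
  the Dirichlet form gives the constant \<open>2 * S / L\<close>.\<close>

lemma poincare:
  "\<exists>c>0. \<forall>x. (\<Sum>i\<in>C. deg i * x i) = 0 \<longrightarrow> c * energy x \<le> dirichlet x"
proof (cases "C = {}")
  case True
  have "energy x = 0" "dirichlet x = 0" for x 
    by (simp_all only: energy_def dirichlet_def) (simp_all add: True)
  then show ?thesis by (intro exI[of _ 1]) simp
next
  case False
  define K where "K i j = (SOME K. 0 \<le> K \<and> (\<forall>x. (x i - x j)\<^sup>2 \<le> K * dirichlet x))" for i j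
  have K: "0 \<le> K i j" "(x i - x j)\<^sup>2 \<le> K i j * dirichlet x" if "i \<in> C" "j \<in> C" for i j x
    using someI_ex[OF square_diff_le_dirichlet[OF that]] by (auto simp: K_def)
  define S where "S = (\<Sum>i\<in>C. deg i)"
  \<comment> \<open>The summand 1 ensures that \<open>L\<close> is positive even if all constants
    \<open>K i j\<close> are 0.\<close>
  define L where "L = 1 + (\<Sum>i\<in>C. \<Sum>j\<in>C. deg i * deg j * K i j)"
  have S: "0 < S" unfolding S_def using False finite_vertices deg_pos by (intro sum_pos) auto
  have "0 \<le> (\<Sum>i\<in>C. \<Sum>j\<in>C. deg i * deg j * K i j)"
    using K(1) deg_pos by (intro sum_nonneg mult_nonneg_nonneg) (auto intro: less_imp_le)
  then have L: "0 < L" by (simp add: L_def)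
  have "2 * S / L * energy x \<le> dirichlet x" if "(\<Sum>i\<in>C. deg i * x i) = 0" for x
  proof -
    have "(\<Sum>i\<in>C. \<Sum>j\<in>C. deg i * deg j * (x i - x j)\<^sup>2)
        = (\<Sum>i\<in>C. \<Sum>j\<in>C. (deg i * (x i)\<^sup>2) * deg j + deg i * (deg j * (x j)\<^sup>2)
            - 2 * ((deg i * x i) * (deg j * x j)))"
      by (intro sum.cong refl) (simp add: power2_eq_square algebra_simps)
    also have "\<dots> = (\<Sum>i\<in>C. \<Sum>j\<in>C. (deg i * (x i)\<^sup>2) * deg j)
        + (\<Sum>i\<in>C. \<Sum>j\<in>C. deg i * (deg j * (x j)\<^sup>2))
        - 2 * (\<Sum>i\<in>C. \<Sum>j\<in>C. (deg i * x i) * (deg j * x j))"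
      by (simp only: sum.distrib sum_subtractf sum_distrib_left)
    also have "\<dots> = energy x * S + S * energy x - 2 * ((\<Sum>i\<in>C. deg i * x i) * (\<Sum>i\<in>C. deg i * x i))"
      by (simp only: energy_def S_def sum_product)
    also have "\<dots> = 2 * S * energy x" using that by simp
    finally have "2 * S * energy x = (\<Sum>i\<in>C. \<Sum>j\<in>C. deg i * deg j * (x i - x j)\<^sup>2)" ..
    also have "\<dots> \<le> (\<Sum>i\<in>C. \<Sum>j\<in>C. deg i * deg j * (K i j * dirichlet x))"
      using K(2) deg_pos by (intro sum_mono mult_left_mono) (auto intro: less_imp_le)
    also have "\<dots> = (L - 1) * dirichlet x"
      by (simp add: L_def sum_distrib_left mult_ac)
    also have "\<dots> \<le> L * dirichlet x" using dirichlet_nonneg[of x] by (simp add: algebra_simps)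
    finally show ?thesis using L by (simp add: field_simps)
  qed
  then show ?thesis using S L by (intro exI[of _ "2 * S / L"]) auto
qed

section \<open>Convergence of the perturbed heat flow\<close>

text \<open>Both \<open>flow\<close> and \<open>h\<close> have sum 0 over \<open>C\<close>, so the
  degree-weighted mean stays 0 and the Poincare inequality is available at every time. It makes the
  energy satisfy the recursion of \<open>contraction_tendsto_zero\<close>, and the energy dominates
  \<open>deg i * (x t i)\<^sup>2\<close>.\<close>

lemma centered_dynamics_tendsto_zero:
  fixes x h :: "nat \<Rightarrow> 'v \<Rightarrow> real"
  assumes step: "\<And>i t. i \<in> C \<Longrightarrow> deg i * (x (Suc t) i - x t i) = (flow (x t) i + h t i) / Suc t"
    and h_lim: "\<And>i. i \<in> C \<Longrightarrow> (\<lambda>t. h t i) \<longlonglongrightarrow> 0"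
    and h_sum: "\<And>t. (\<Sum>i\<in>C. h t i) = 0"
    and bounded: "\<And>i t. i \<in> C \<Longrightarrow> \<bar>x t i\<bar> \<le> K"
    and centered: "(\<Sum>i\<in>C. deg i * x 0 i) = 0"
    and "i \<in> C"
  shows "(\<lambda>t. x t i) \<longlonglongrightarrow> 0"
proof -
  have centered_all: "(\<Sum>i\<in>C. deg i * x t i) = 0" for t
  proof (induction t)
    case (Suc t)
    have "(\<Sum>i\<in>C. deg i * x (Suc t) i) = (\<Sum>i\<in>C. deg i * x t i + (flow (x t) i + h t i) / Suc t)"
    proof (rule sum.cong[OF refl])
      fix i assume "i \<in> C"
      from step[OF this, of t]
      show "deg i * x (Suc t) i = deg i * x t i + (flow (x t) i + h t i) / Suc t"
        by (simp only: right_diff_distrib)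
    qed
    then show ?case
      using Suc sum_flow[of "x t"] h_sum[of t]
      by (simp add: sum.distrib sum_divide_distrib[symmetric] del: of_nat_Suc)
  qed (rule centered)
  obtain c where c: "0 < c" "\<And>x. (\<Sum>i\<in>C. deg i * x i) = 0 \<Longrightarrow> c * energy x \<le> dirichlet x"
    using poincare by blast
  have flow_bound: "\<bar>flow (x t) i\<bar> \<le> 2 * K * deg i" if "i \<in> C" for t i
  proof -
    have "\<bar>flow (x t) i\<bar> \<le> (\<Sum>j\<in>C. \<bar>w i j * (x t j - x t i)\<bar>)"
      unfolding flow_def by (rule sum_abs)
    also have "\<dots> \<le> (\<Sum>j\<in>C. w i j * (2 * K))"
    proof (rule sum_mono)
      fix j assume "j \<in> C"
      have "\<bar>x t j - x t i\<bar> \<le> 2 * K" using bounded[OF \<open>j \<in> C\<close>, of t] bounded[OF that, of t] by linarith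
      then show "\<bar>w i j * (x t j - x t i)\<bar> \<le> w i j * (2 * K)"
        using weight_nonneg[of i j] by (simp add: abs_mult mult_left_mono)
    qed
    also have "\<dots> = 2 * K * deg i" by (simp add: deg_def sum_distrib_left mult_ac)
    finally show ?thesis .
  qed
  \<comment> \<open>The first part bounds the cross terms of \<open>x\<close> and \<open>h\<close>
    and vanishes with \<open>h\<close>; the second bounds the quadratic terms, which stay bounded
    and are damped by the remaining factor \<open>1 / Suc t\<close>.\<close>
  define \<delta> where "\<delta> t = 2 * (\<Sum>i\<in>C. K * \<bar>h t i\<bar>)
      + (\<Sum>i\<in>C. (2 * K * deg i + \<bar>h t i\<bar>)\<^sup>2 / deg i) * (1 / Suc t)" for t
  have \<delta>: "\<delta> \<longlonglongrightarrow> 0"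
  proof -
    have "(\<lambda>t. 1 / real (Suc t)) \<longlonglongrightarrow> 0" by real_asymp
    then have "(\<lambda>t. 2 * (\<Sum>i\<in>C. K * \<bar>h t i\<bar>)
        + (\<Sum>i\<in>C. (2 * K * deg i + \<bar>h t i\<bar>)\<^sup>2 / deg i) * (1 / Suc t))
      \<longlonglongrightarrow> 2 * (\<Sum>i\<in>C. K * \<bar>0\<bar>) + (\<Sum>i\<in>C. (2 * K * deg i + \<bar>0\<bar>)\<^sup>2 / deg i) * 0"
      using deg_pos by (intro tendsto_intros h_lim) (auto dest: deg_pos)
    then show ?thesis by (simp add: \<delta>_def[abs_def])
  qed
  have "(\<lambda>t. energy (x t)) \<longlonglongrightarrow> 0"
  proof (rule contraction_tendsto_zero[OF c(1) _ \<delta>])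
    show "0 \<le> energy (x t)" for t
      unfolding energy_def using deg_pos by (intro sum_nonneg mult_nonneg_nonneg) (auto intro: less_imp_le)
    fix t
    let ?T = "real (Suc t)"
    have "energy (x (Suc t)) = (\<Sum>i\<in>C. deg i * (x t i)\<^sup>2 + (2 * (x t i * flow (x t) i)) / ?T
        + (2 * (x t i * h t i)) / ?T + (flow (x t) i + h t i)\<^sup>2 / deg i * (1 / ?T) / ?T)"
      unfolding energy_def
    proof (rule sum.cong[OF refl])
      fix i assume i: "i \<in> C"
      show "deg i * (x (Suc t) i)\<^sup>2 = deg i * (x t i)\<^sup>2 + (2 * (x t i * flow (x t) i)) / ?T
        + (2 * (x t i * h t i)) / ?T + (flow (x t) i + h t i)\<^sup>2 / deg i * (1 / ?T) / ?T"
        by (rule weighted_square_step[OF deg_pos[OF i] step[OF i]])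
    qed
    also have "\<dots> = energy (x t) + (2 * (\<Sum>i\<in>C. x t i * flow (x t) i)) / ?T
        + (2 * (\<Sum>i\<in>C. x t i * h t i)) / ?T
        + ((\<Sum>i\<in>C. (flow (x t) i + h t i)\<^sup>2 / deg i) * (1 / ?T)) / ?T"
      unfolding energy_def sum.distrib sum_divide_distrib sum_distrib_left sum_distrib_right ..
    also have "\<dots> \<le> energy (x t) + (- (c * energy (x t))) / ?T
        + (2 * (\<Sum>i\<in>C. K * \<bar>h t i\<bar>)) / ?T
        + ((\<Sum>i\<in>C. (2 * K * deg i + \<bar>h t i\<bar>)\<^sup>2 / deg i) * (1 / ?T)) / ?T"
    proof (intro add_mono divide_right_mono mult_right_mono mult_left_mono sum_mono order_refl)
      \<comment> \<open>The only term that is not an error: by \<open>sum_mult_flow\<close> it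
        equals minus the Dirichlet form, and the Poincare inequality turns this into decay
        proportional to the energy.\<close>
      show "2 * (\<Sum>i\<in>C. x t i * flow (x t) i) \<le> - (c * energy (x t))"
        using c(2)[OF centered_all] sum_mult_flow[of "x t"] by simp
      fix i assume i: "i \<in> C"
      have "x t i * h t i \<le> \<bar>x t i\<bar> * \<bar>h t i\<bar>" by (simp flip: abs_mult)
      also have "\<dots> \<le> K * \<bar>h t i\<bar>" by (rule mult_right_mono[OF bounded[OF i]]) simp
      finally show "x t i * h t i \<le> K * \<bar>h t i\<bar>" .
      have "\<bar>flow (x t) i + h t i\<bar> \<le> \<bar>2 * K * deg i + \<bar>h t i\<bar>\<bar>"
        using flow_bound[OF i, of t] by linarith
      then show "(flow (x t) i + h t i)\<^sup>2 \<le> (2 * K * deg i + \<bar>h t i\<bar>)\<^sup>2"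
        by (simp only: abs_le_square_iff)
      show "0 \<le> deg i" using deg_pos[OF i] by simp
    qed auto
    also have "\<dots> = (1 - c / ?T) * energy (x t) + \<delta> t / ?T"
      unfolding \<delta>_def left_diff_distrib add_divide_distrib by simp
    finally show "energy (x (Suc t)) \<le> (1 - c / ?T) * energy (x t) + \<delta> t / ?T" .
  qed
  then have lim: "(\<lambda>t. energy (x t) / deg i) \<longlonglongrightarrow> 0" by (rule tendsto_divide_zero)
  have "norm ((x t i)\<^sup>2) \<le> energy (x t) / deg i" for t
  proof -
    have "deg i * (x t i)\<^sup>2 \<le> energy (x t)"
      unfolding energy_def using deg_pos finite_vertices \<open>i \<in> C\<close>
      by (intro member_le_sum[of i C "\<lambda>i. deg i * (x t i)\<^sup>2"] mult_nonneg_nonneg) (auto intro: less_imp_le)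
    then show ?thesis using deg_pos[OF \<open>i \<in> C\<close>] by (simp add: field_simps)
  qed
  then have "(\<lambda>t. (x t i)\<^sup>2) \<longlonglongrightarrow> 0"
    by (intro Lim_null_comparison[OF always_eventually lim] allI)
  from tendsto_real_sqrt[OF this] have "(\<lambda>t. \<bar>x t i\<bar>) \<longlonglongrightarrow> 0" by simp
  then show ?thesis by (rule tendsto_rabs_zero_cancel)
qed

text \<open>Adding the scaled tail sums \<open>r\<close> to \<open>z\<close> cancels
  \<open>\<epsilon>\<close> exactly. The corrected process \<open>y\<close> follows the heat flow up
  to \<open>- flow (r t)\<close>, which tends to 0 with \<open>r\<close> and has sum 0 over
  \<open>C\<close>; so \<open>y\<close> minus its conserved mean \<open>m\<close> falls under the
  centered case, and \<open>z\<close> has the same limit \<open>m\<close> as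
  \<open>y\<close>.\<close>

lemma perturbed_dynamics_convergent:
  fixes z \<epsilon> :: "nat \<Rightarrow> 'v \<Rightarrow> real"
  assumes step: "\<And>i t. i \<in> C \<Longrightarrow> deg i * (z (Suc t) i - z t i) = flow (z t) i / Suc t + \<epsilon> t i"
    and summable: "\<And>i. i \<in> C \<Longrightarrow> summable (\<lambda>t. \<epsilon> t i)"
    and bounded: "\<And>i t. i \<in> C \<Longrightarrow> \<bar>z t i\<bar> \<le> K"
    and "i \<in> C"
  shows "convergent (\<lambda>t. z t i)"
proof -
  define r where "r t i = (\<Sum>s. \<epsilon> (s + t) i) / deg i" for t i
  define y where "y t i = z t i + r t i" for t i
  define m where "m = (\<Sum>i\<in>C. deg i * y 0 i) / (\<Sum>i\<in>C. deg i)"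
  have r_lim: "(\<lambda>t. r t i) \<longlonglongrightarrow> 0" if "i \<in> C" for i
    unfolding r_def using tendsto_divide_zero[OF suminf_exist_split2[OF summable[OF that]]] .
  have r_step: "deg i * (r (Suc t) i - r t i) = - \<epsilon> t i" if "i \<in> C" for i t
  proof -
    have "summable (\<lambda>s. \<epsilon> (s + t) i)" using summable[OF that] by (rule summable_ignore_initial_segment)
    from suminf_split_head[OF this]
    have "(\<Sum>s. \<epsilon> (s + Suc t) i) - (\<Sum>s. \<epsilon> (s + t) i) = - \<epsilon> t i" by simp
    moreover have "deg i * (r (Suc t) i - r t i) = (\<Sum>s. \<epsilon> (s + Suc t) i) - (\<Sum>s. \<epsilon> (s + t) i)"
      using deg_pos[OF that] unfolding r_def right_diff_distrib by simp
    ultimately show ?thesis by (rule trans[rotated])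
  qed
  have "\<exists>B. \<forall>t. \<forall>i\<in>C. \<bar>y t i - m\<bar> \<le> B"
  proof -
    have "\<forall>i\<in>C. \<exists>B. \<forall>t. \<bar>r t i\<bar> \<le> B"
      using convergent_imp_Bseq[OF convergentI[OF r_lim]] by (auto simp: Bseq_def)
    then obtain B where B: "\<And>i t. i \<in> C \<Longrightarrow> \<bar>r t i\<bar> \<le> B i" by metis
    have "\<bar>y t i - m\<bar> \<le> K + (\<Sum>i\<in>C. \<bar>B i\<bar>) + \<bar>m\<bar>" if "i \<in> C" for t i
    proof -
      have "\<bar>B i\<bar> \<le> (\<Sum>i\<in>C. \<bar>B i\<bar>)" using finite_vertices that by (intro member_le_sum) auto
      then show ?thesis using B[OF that, of t] bounded[OF that, of t] unfolding y_def by linarith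
    qed
    then show ?thesis by blast
  qed
  then obtain B where B: "\<And>i t. i \<in> C \<Longrightarrow> \<bar>y t i - m\<bar> \<le> B" by blast
  have "(\<lambda>t. y t i - m) \<longlonglongrightarrow> 0"
  proof (rule centered_dynamics_tendsto_zero[where h = "\<lambda>t i. - flow (r t) i", OF _ _ _ B _ \<open>i \<in> C\<close>])
    show "(\<lambda>t. - flow (r t) i) \<longlonglongrightarrow> 0" if "i \<in> C" for i
    proof -
      have "(\<lambda>t. - flow (r t) i) \<longlonglongrightarrow> - (\<Sum>j\<in>C. w i j * (0 - 0))"
        unfolding flow_def by (intro tendsto_intros r_lim that)
      then show ?thesis by simp
    qed
    show "(\<Sum>i\<in>C. - flow (r t) i) = 0" for t by (simp add: sum_negf sum_flow)
    have "0 < (\<Sum>i\<in>C. deg i)" using deg_pos finite_vertices \<open>i \<in> C\<close> by (intro sum_pos) auto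
    then have "(\<Sum>i\<in>C. deg i) * m = (\<Sum>i\<in>C. deg i * y 0 i)"
      unfolding m_def by simp
    moreover have "(\<Sum>i\<in>C. deg i * (y 0 i - m)) = (\<Sum>i\<in>C. deg i * y 0 i) - (\<Sum>i\<in>C. deg i) * m"
      by (simp add: right_diff_distrib sum_subtractf sum_distrib_right)
    ultimately show "(\<Sum>i\<in>C. deg i * (y 0 i - m)) = 0" by simp
    fix i t assume i: "i \<in> C"
    have "flow (y t) i = flow (z t) i + flow (r t) i"
      unfolding y_def by (rule flow_add)
    then have "flow (\<lambda>i. y t i - m) i + - flow (r t) i = flow (z t) i"
      by (simp add: flow_diff_const)
    moreover have "deg i * (y (Suc t) i - m - (y t i - m)) = deg i * (z (Suc t) i - z t i) + deg i * (r (Suc t) i - r t i)"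
      unfolding y_def by (simp add: algebra_simps)
    ultimately show "deg i * (y (Suc t) i - m - (y t i - m)) = (flow (\<lambda>i. y t i - m) i + - flow (r t) i) / Suc t"
      using step[OF i, of t] r_step[OF i, of t] by simp
  qed
  from tendsto_diff[OF tendsto_add[OF this tendsto_const[of m]] r_lim[OF \<open>i \<in> C\<close>]]
  have "(\<lambda>t. z t i) \<longlonglongrightarrow> m" by (simp add: y_def)
  then show ?thesis by (rule convergentI)
qed

end

subsection \<open>The urn process\<close>

lemma black_proportion_eq:
  "black_proportion E correct X t i \<omega> = real (black E correct X t i \<omega>) / (1 + real (degree E i) * real t)"
  unfolding black_proportion_def urn_total by simp

lemma black_proportion_bounds:
  "0 \<le> black_proportion E correct X t i \<omega>" "black_proportion E correct X t i \<omega> \<le> 1"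
  by (auto simp: black_proportion_def divide_simps)

lemma abs_of_bool_diff_black_proportion_le:
  "\<bar>of_bool b - black_proportion E correct X t i \<omega>\<bar> \<le> 1"
  using black_proportion_bounds[of E correct X t i \<omega>] by (cases b) auto

text \<open>The urn grows from \<open>1 + d * t\<close> to \<open>1 + d * Suc t\<close> balls, so
  each new ball contributes its deviation from the old proportion. For an isolated agent both sides
  are 0.\<close>

lemma black_proportion_step:
  fixes E :: "'v set set"
  assumes "finite (neighbors E i)"
  defines "d \<equiv> real (degree E i)"
  shows "black_proportion E correct X (Suc t) i \<omega> - black_proportion E correct X t i \<omega>
    = (\<Sum>j\<in>neighbors E i. of_bool (X (Suc t) j \<omega>) - black_proportion E correct X t i \<omega>) / (1 + d * Suc t)"
proof -
  let ?z = "black_proportion E correct X t i \<omega>"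
  have d: "0 \<le> d" by (simp add: d_def)
  have pos: "0 < 1 + d * real t" "0 < 1 + d * real (Suc t)"
    using d by (auto intro: add_pos_nonneg)
  have black: "real (black E correct X t i \<omega>) = ?z * (1 + d * real t)"
    using pos by (simp add: black_proportion_eq d_def)
  have "black_proportion E correct X (Suc t) i \<omega>
      = (?z * (1 + d * real t) + (\<Sum>j\<in>neighbors E i. of_bool (X (Suc t) j \<omega>))) / (1 + d * Suc t)"
    by (subst black_proportion_eq) (simp add: black d_def)
  moreover have "(\<Sum>j\<in>neighbors E i. of_bool (X (Suc t) j \<omega>) - ?z)
      = (\<Sum>j\<in>neighbors E i. of_bool (X (Suc t) j \<omega>)) - d * ?z"
    by (simp add: sum_subtractf d_def)
  ultimately show ?thesis
    using pos by (simp add: field_simps)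
qed

lemma neighbors_subset: "loopless_graph V E \<Longrightarrow> neighbors E i \<subseteq> V"
  by (fastforce simp: loopless_graph_def neighbors_def doubleton_eq_iff)

section \<open>Connected components and the pathwise argument\<close>

text \<open>The component is the set of vertices reachable from \<open>i\<close>, with 0/1 weights.
  Closure under neighbors lets sums over neighbors be read as weighted sums over \<open>C\<close>,
  and symmetry of adjacency turns paths from \<open>i\<close> into paths between any two
  vertices.\<close>

lemma weighted_network_component:
  assumes graph: "loopless_graph V E" and "i \<in> V" and nonisolated: "neighbors E i \<noteq> {}"
  defines "C \<equiv> {j. (i, j) \<in> {(a, b). {a, b} \<in> E}\<^sup>*}"
  shows "i \<in> C" "C \<subseteq> V" "\<And>j. j \<in> C \<Longrightarrow> neighbors E j \<subseteq> C"
    "weighted_network C (\<lambda>a b. of_bool ({a, b} \<in> E))"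
proof -
  let ?R = "{(a, b). {a, b} \<in> E}"
  show iC: "i \<in> C" by (simp add: C_def)
  show CV: "C \<subseteq> V"
  proof
    fix j assume "j \<in> C"
    then have "(i, j) \<in> ?R\<^sup>*" by (simp add: C_def)
    then show "j \<in> V"
      by (induction rule: rtrancl_induct)
         (use \<open>i \<in> V\<close> neighbors_subset[OF graph] in \<open>auto simp: neighbors_def\<close>)
  qed
  show closed: "neighbors E j \<subseteq> C" if "j \<in> C" for j
    using that by (auto simp: C_def neighbors_def intro: rtrancl_into_rtrancl)
  have fin: "finite C" using CV graph by (auto simp: loopless_graph_def intro: finite_subset)
  let ?w = "\<lambda>a b. of_bool ({a, b} \<in> E) :: real"
  let ?S = "{(a, b). a \<in> C \<and> b \<in> C \<and> 0 < ?w a b}"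
  \<comment> \<open>Every vertex on a path starting at \<open>i\<close> is itself reachable from
    \<open>i\<close>, so the path never leaves \<open>C\<close>.\<close>
  have from_i: "(i, j) \<in> ?S\<^sup>*" if "j \<in> C" for j
  proof -
    have "(i, j) \<in> ?R\<^sup>*" using that by (simp add: C_def)
    then show ?thesis
    proof (induction rule: rtrancl_induct)
      case (step j k)
      then have "(j, k) \<in> ?S" by (auto simp: C_def intro: rtrancl_into_rtrancl)
      then show ?case using step.IH by (rule rtrancl_into_rtrancl[rotated])
    qed simp
  qed
  have "sym ?S" by (auto simp: sym_def insert_commute)
  then have sym: "sym (?S\<^sup>*)" by (rule sym_rtrancl)
  show "weighted_network C ?w"
  proof
    fix j assume j: "j \<in> C"
    \<comment> \<open>A vertex other than \<open>i\<close> has as neighbor its predecessor on a path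
      from \<open>i\<close>; for \<open>i\<close> itself the assumption \<open>nonisolated\<close>
      is used.\<close>
    have "\<exists>k. k \<in> neighbors E j"
    proof (cases "j = i")
      case False
      have "(i, j) \<in> ?R\<^sup>*" using j by (simp add: C_def)
      then obtain k where "(k, j) \<in> ?R" using False by (metis rtranclE)
      then show ?thesis by (auto simp: neighbors_def insert_commute)
    qed (use nonisolated in auto)
    then obtain k where k: "k \<in> neighbors E j" by blast
    then have "k \<in> C" using closed[OF j] by blast
    then show "0 < (\<Sum>k\<in>C. ?w j k)"
      using k fin by (intro sum_pos2[of C k]) (auto simp: neighbors_def)
  next
    fix j k assume "j \<in> C" "k \<in> C"
    then show "(j, k) \<in> ?S\<^sup>*"
      using from_i symD[OF sym] by (meson rtrancl_trans)
  qed (auto simp: fin insert_commute)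
qed

text \<open>The pathwise half of the argument, for a fixed outcome with summable noise. An isolated
  agent keeps a constant proportion; otherwise the component of \<open>i\<close> carries a perturbed
  heat flow.\<close>

lemma convergent_black_proportion:
  assumes graph: "loopless_graph V E" and "i \<in> V"
    and noise: "\<And>j. j \<in> V \<Longrightarrow>
      summable (\<lambda>t. (of_bool (X (Suc t) j \<omega>) - black_proportion E correct X t j \<omega>) / real (Suc t))"
  shows "convergent (\<lambda>t. black_proportion E correct X t i \<omega>)"
proof (cases "neighbors E i = {}")
  case True
  then have "black_proportion E correct X t i \<omega> = black_proportion E correct X 0 i \<omega>" for t
    by (induction t) (use black_proportion_step[of E i correct X _ \<omega>] in simp_all)
  then have "(\<lambda>t. black_proportion E correct X t i \<omega>) = (\<lambda>_. black_proportion E correct X 0 i \<omega>)"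
    by (rule ext)
  then show ?thesis by (simp only: convergent_const)
next
  case False
  define C where "C = {j. (i, j) \<in> {(a, b). {a, b} \<in> E}\<^sup>*}"
  note component = weighted_network_component[OF graph \<open>i \<in> V\<close> False, folded C_def]
  let ?w = "\<lambda>a b. of_bool ({a, b} \<in> E) :: real"
  interpret weighted_network C ?w by (rule component(4))
  define z where "z t j = black_proportion E correct X t j \<omega>" for t j
  define d where "d j = real (degree E j)" for j
  define G where "G t j = (\<Sum>k\<in>neighbors E j. of_bool (X (Suc t) k \<omega>) - z t j)" for t j
  \<comment> \<open>Two sources of error: the noise in the draws of the neighbors, summable by
    assumption, and the replacement of the true step size \<open>d j / (1 + d j * Suc t)\<close> by
    \<open>1 / Suc t\<close>.\<close>
  define \<epsilon> where "\<epsilon> t j = (\<Sum>k\<in>neighbors E j. (of_bool (X (Suc t) k \<omega>) - z t k) / Suc t)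
    + G t j * (d j / (1 + d j * Suc t) - 1 / Suc t)" for t j
  have sum_w: "(\<Sum>k\<in>C. ?w j k * f k) = (\<Sum>k\<in>neighbors E j. f k)" if "j \<in> C" for j and f :: "'a \<Rightarrow> real"
  proof -
    have "(\<Sum>k\<in>C. ?w j k * f k) = (\<Sum>k\<in>neighbors E j. ?w j k * f k)"
      using component(3)[OF that] finite_vertices by (intro sum.mono_neutral_right) (auto simp: neighbors_def)
    then show ?thesis by (simp add: neighbors_def)
  qed
  have deg: "deg j = d j" if "j \<in> C" for j
    using sum_w[OF that, of "\<lambda>_. 1"] by (simp add: deg_def d_def)
  have flow: "flow (z t) j = (\<Sum>k\<in>neighbors E j. z t k - z t j)" if "j \<in> C" for t j
    unfolding flow_def by (rule sum_w[OF that])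
  have "convergent (\<lambda>t. z t i)"
  proof (rule perturbed_dynamics_convergent[where K = 1 and \<epsilon> = \<epsilon>])
    show "i \<in> C" by (rule component(1))
    show "\<bar>z t j\<bar> \<le> 1" for t j
      using black_proportion_bounds[of E correct X t j \<omega>] by (simp add: z_def)
    fix j assume j: "j \<in> C"
    have d1: "1 \<le> d j" using deg_pos[OF j] by (simp add: deg[OF j]) (simp add: d_def)
    show "deg j * (z (Suc t) j - z t j) = flow (z t) j / Suc t + \<epsilon> t j" for t
    proof -
      have "z (Suc t) j - z t j = G t j / (1 + d j * Suc t)"
        unfolding z_def G_def d_def by (rule black_proportion_step[OF finite_neighbors[OF graph]])
      moreover have "G t j = flow (z t) j + (\<Sum>k\<in>neighbors E j. of_bool (X (Suc t) k \<omega>) - z t k)"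
        unfolding G_def flow[OF j] by (simp flip: sum.distrib)
      then have "(\<Sum>k\<in>neighbors E j. (of_bool (X (Suc t) k \<omega>) - z t k) / Suc t) = (G t j - flow (z t) j) / Suc t"
        by (simp add: sum_divide_distrib)
      ultimately show ?thesis
        unfolding \<epsilon>_def deg[OF j] by (simp add: right_diff_distrib diff_divide_distrib)
    qed
    have "summable (\<lambda>t. \<Sum>k\<in>neighbors E j. (of_bool (X (Suc t) k \<omega>) - z t k) / Suc t)"
      unfolding z_def using neighbors_subset[OF graph] by (intro summable_sum noise) auto
    moreover have "summable (\<lambda>t. G t j * (d j / (1 + d j * Suc t) - 1 / Suc t))"
    \<comment> \<open>\<open>G\<close> is at most \<open>d j\<close> in absolute value, and the two
      step sizes differ by \<open>1 / (T * (1 + d j * T))\<close> with \<open>T = Suc t\<close>. As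
      \<open>d j\<close> is at least 1, this is at most the inverse square of
      \<open>T\<close>.\<close>
    proof (rule summable_comparison_test')
      show "summable (\<lambda>t. d j * inverse (real (Suc t) ^ 2))"
        using inverse_power_summable[of 2, where 'a = real]
        by (intro summable_mult) (subst summable_Suc_iff, simp)
      fix t
      have "\<bar>G t j\<bar> \<le> (\<Sum>k\<in>neighbors E j. \<bar>of_bool (X (Suc t) k \<omega>) - z t j\<bar>)"
        unfolding G_def by (rule sum_abs)
      also have "\<dots> \<le> (\<Sum>k\<in>neighbors E j. 1)"
        unfolding z_def by (intro sum_mono abs_of_bool_diff_black_proportion_le)
      finally have G: "\<bar>G t j\<bar> \<le> d j" by (simp add: d_def)
      let ?T = "real (Suc t)"
      have T: "0 < ?T" "?T \<le> d j * ?T" using d1 by auto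
      then have pos: "0 < 1 + d j * ?T" by linarith
      have "d j / (1 + d j * ?T) - 1 / ?T = - (1 / (?T * (1 + d j * ?T)))"
        using T pos by (simp add: divide_simps del: of_nat_Suc)
      then have "\<bar>d j / (1 + d j * ?T) - 1 / ?T\<bar> = 1 / (?T * (1 + d j * ?T))"
        using T by (simp add: abs_mult del: of_nat_Suc)
      also have "\<dots> \<le> 1 / (?T * ?T)"
        using T by (intro divide_left_mono mult_left_mono mult_pos_pos) linarith+
      finally have "\<bar>d j / (1 + d j * ?T) - 1 / ?T\<bar> \<le> inverse (?T ^ 2)"
        by (simp add: power2_eq_square inverse_eq_divide del: of_nat_Suc)
      then show "norm (G t j * (d j / (1 + d j * ?T) - 1 / ?T)) \<le> d j * inverse (?T ^ 2)"
        unfolding real_norm_def abs_mult using G by (intro mult_mono) auto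
    qed
    ultimately show "summable (\<lambda>t. \<epsilon> t j)" unfolding \<epsilon>_def by (rule summable_add)
  qed
  then show ?thesis by (simp add: z_def)
qed

section \<open>Adaptedness and orthogonality of the noise\<close>

context interacting_urn_process
begin

abbreviation "\<F> \<equiv> urn_filtration M V E correct X"

abbreviation "Z \<equiv> black_proportion E correct X"

lemma space_filtration [simp]: "space (\<F> t) = space M"
  unfolding urn_filtration_def by (rule space_measure_of) auto

lemma sets_filtration:
  "sets (\<F> t) = sigma_sets (space M)
     ({{\<omega> \<in> space M. black E correct X 0 i \<omega> = n} | i n. i \<in> V} \<union>
      {{\<omega> \<in> space M. white E correct X 0 i \<omega> = n} | i n. i \<in> V} \<union>
      {{\<omega> \<in> space M. X k i \<omega>} | k i. i \<in> V \<and> 1 \<le> k \<and> k \<le> t})"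
  unfolding urn_filtration_def by (rule sets_measure_of) auto

lemma subalgebra_filtration: "subalgebra M (\<F> t)"
  unfolding subalgebra_def sets_filtration
proof (intro conjI sets.sigma_sets_subset)
  have "{\<omega> \<in> space M. black E correct X 0 i \<omega> = n} \<in> sets M"
    "{\<omega> \<in> space M. white E correct X 0 i \<omega> = n} \<in> sets M" if "i \<in> V" for i n
    using measurable_correct[OF that] by simp_all
  moreover have "{\<omega> \<in> space M. X k i \<omega>} \<in> sets M" if "i \<in> V" "1 \<le> k" for k i
    using measurable_draw[OF that(1), of "k - 1"] that(2) by simp
  ultimately show "({{\<omega> \<in> space M. black E correct X 0 i \<omega> = n} | i n. i \<in> V} \<union>
      {{\<omega> \<in> space M. white E correct X 0 i \<omega> = n} | i n. i \<in> V} \<union>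
      {{\<omega> \<in> space M. X k i \<omega>} | k i. i \<in> V \<and> 1 \<le> k \<and> k \<le> t}) \<subseteq> sets M"
    by blast
qed simp

lemma measurable_draw_filtration:
  assumes "i \<in> V" "s < t"
  shows "(\<lambda>\<omega>. of_bool (X (Suc s) i \<omega>) :: real) \<in> borel_measurable (\<F> t)"
proof -
  have "{\<omega> \<in> space M. X (Suc s) i \<omega>} \<in> sets (\<F> t)"
    unfolding sets_filtration using assms by (intro sigma_sets.Basic) force
  then have "Measurable.pred (\<F> t) (X (Suc s) i)" by (simp add: pred_def)
  then show ?thesis by measurable
qed

lemma measurable_black_filtration:
  assumes graph: "loopless_graph V E" and "i \<in> V" "s \<le> t"
  shows "(\<lambda>\<omega>. real (black E correct X s i \<omega>)) \<in> borel_measurable (\<F> t)"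
  using \<open>s \<le> t\<close>
proof (induction s)
  case 0
  have "{\<omega> \<in> space M. black E correct X 0 i \<omega> = n} \<in> sets (\<F> t)" for n
    unfolding sets_filtration using \<open>i \<in> V\<close> by (intro sigma_sets.Basic) blast
  \<comment> \<open>The values lie in the countable set of naturals, so the preimages of points,
    which are generators of the filtration, suffice.\<close>
  then have "black E correct X 0 i \<in> measurable (\<F> t) (count_space UNIV)"
    by (subst measurable_count_space_eq2_countable) (auto simp: vimage_def Int_def conj_commute)
  then show ?case by (rule measurable_compose) simp
next
  case (Suc s)
  have "(\<lambda>\<omega>. real (black E correct X s i \<omega>) + (\<Sum>j\<in>neighbors E i. of_bool (X (Suc s) j \<omega>)))
      \<in> borel_measurable (\<F> t)"
    using Suc neighbors_subset[OF graph, of i]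
    by (intro borel_measurable_add borel_measurable_sum measurable_draw_filtration) auto
  then show ?case by simp
qed

lemma measurable_proportion_filtration:
  assumes "loopless_graph V E" "i \<in> V" "s \<le> t"
  shows "Z s i \<in> borel_measurable (\<F> t)"
  unfolding black_proportion_eq[abs_def]
  using measurable_black_filtration[OF assms] by measurable

text \<open>The noise terms are martingale differences bounded by 1. For \<open>m < n\<close> the
  earlier one is known at time \<open>n\<close>, while the later one has conditional mean 0 given
  \<open>\<F> n\<close>; hence they are orthogonal and the series theorem applies.\<close>

lemma summable_noise:
  assumes graph: "loopless_graph V E" and i: "i \<in> V"
  shows "AE \<omega> in M. summable (\<lambda>t. (of_bool (X (Suc t) i \<omega>) - Z t i \<omega>) / real (Suc t))"
proof (rule orthogonal_bounded_series_convergent[OF prob_space_axioms])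
  let ?x = "\<lambda>t \<omega>. of_bool (X (Suc t) i \<omega>) - Z t i \<omega>"
  \<comment> \<open>The inequality is strict because the term with index \<open>s\<close> contains
    the draw at step \<open>Suc s\<close>.\<close>
  have adapted: "?x s \<in> borel_measurable (\<F> t)" if "s < t" for s t
    using that
    by (intro borel_measurable_diff measurable_draw_filtration measurable_proportion_filtration graph i) auto
  show meas: "?x t \<in> borel_measurable M" for t
    using measurable_from_subalg[OF subalgebra_filtration adapted[OF lessI]] .
  show "\<bar>?x t \<omega>\<bar> \<le> 1" for t \<omega> by (rule abs_of_bool_diff_black_proportion_le)
  fix m n :: nat assume "m < n"
  let ?I = "indicator {\<omega> \<in> space M. X (Suc n) i \<omega>} :: _ \<Rightarrow> real"
  interpret F: finite_measure_subalgebra M "\<F> n"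
    by unfold_locales (rule subalgebra_filtration)
  note x_meas [measurable] = meas[of m]
  have [measurable]: "Z n i \<in> borel_measurable M"
    using measurable_from_subalg[OF subalgebra_filtration measurable_proportion_filtration[OF graph i order_refl]] .
  have I_meas [measurable]: "?I \<in> borel_measurable M"
    using measurable_draw[OF i, of n] by measurable
  have x_bound: "\<bar>?x m \<omega>\<bar> \<le> 1" for \<omega> by (rule abs_of_bool_diff_black_proportion_le)
  have int_I: "integrable M (\<lambda>\<omega>. ?x m \<omega> * ?I \<omega>)"
  proof (rule integrable_const_bound[where B = 1])
    show "AE \<omega> in M. norm (?x m \<omega> * ?I \<omega>) \<le> 1"
      unfolding real_norm_def abs_mult
      by (intro AE_I2 mult_le_one x_bound) (auto simp: indicator_def)
  qed measurable
  have int_Z: "integrable M (\<lambda>\<omega>. ?x m \<omega> * Z n i \<omega>)"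
  proof (rule integrable_const_bound[where B = 1])
    show "AE \<omega> in M. norm (?x m \<omega> * Z n i \<omega>) \<le> 1"
      unfolding real_norm_def abs_mult
      using black_proportion_bounds[of E correct X n i]
      by (intro AE_I2 mult_le_one x_bound) auto
  qed measurable
  \<comment> \<open>The factor \<open>?x m\<close> is measurable for \<open>\<F> n\<close>, so the
    indicator of the next draw may be replaced by its conditional expectation, which
    \<open>prob_draw\<close> identifies almost everywhere with \<open>Z n i\<close>.\<close>
  have "(\<integral>\<omega>. ?x m \<omega> * ?I \<omega> \<partial>M) = (\<integral>\<omega>. ?x m \<omega> * real_cond_exp M (\<F> n) ?I \<omega> \<partial>M)"
    by (rule F.real_cond_exp_intg(2)[symmetric]) (use int_I adapted[OF \<open>m < n\<close>] I_meas in auto)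
  also have "\<dots> = (\<integral>\<omega>. ?x m \<omega> * Z n i \<omega> \<partial>M)"
  proof (rule integral_cong_AE)
    show "AE \<omega> in M. ?x m \<omega> * real_cond_exp M (\<F> n) ?I \<omega> = ?x m \<omega> * Z n i \<omega>"
      using prob_draw[OF i, of n] by eventually_elim simp
  qed measurable
  finally have "(\<integral>\<omega>. ?x m \<omega> * ?I \<omega> - ?x m \<omega> * Z n i \<omega> \<partial>M) = 0"
    using int_I int_Z by simp
  moreover have "(\<integral>\<omega>. ?x m \<omega> * ?x n \<omega> \<partial>M) = (\<integral>\<omega>. ?x m \<omega> * ?I \<omega> - ?x m \<omega> * Z n i \<omega> \<partial>M)"
    by (rule Bochner_Integration.integral_cong) (auto simp: right_diff_distrib indicator_def)
  ultimately show "(\<integral>\<omega>. ?x m \<omega> * ?x n \<omega> \<partial>M) = 0" by simp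
qed

end

theorem theorem1:
  fixes N :: nat and E :: "nat set set" and \<alpha> :: real and M :: "'a measure"
    and correct :: "nat \<Rightarrow> 'a \<Rightarrow> bool" and X :: "nat \<Rightarrow> nat \<Rightarrow> 'a \<Rightarrow> bool"
  assumes "loopless_graph {1..N} E"
    and "0 \<le> \<alpha>" and "\<alpha> \<le> 1"
    and "interacting_urn_process M {1..N} E \<alpha> correct X"
  shows "AE \<omega> in M. \<forall>i\<in>{1..N}. convergent (\<lambda>t. black_proportion E correct X t i \<omega>)"
proof -
  interpret interacting_urn_process M "{1..N}" E \<alpha> correct X by fact
  \<comment> \<open>Finitely many exceptional null sets are merged, because the pathwise argument at
    one vertex needs summable noise at all vertices simultaneously.\<close>
  have "AE \<omega> in M. \<forall>i\<in>{1..N}. summable (\<lambda>t. (of_bool (X (Suc t) i \<omega>) - Z t i \<omega>) / real (Suc t))"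
    using summable_noise[OF assms(1)] by (intro AE_finite_allI) auto
  then show ?thesis
  proof eventually_elim
    case (elim \<omega>)
    show ?case
    proof
      fix i assume "i \<in> {1..N}"
      show "convergent (\<lambda>t. Z t i \<omega>)"
        by (rule convergent_black_proportion[OF assms(1) \<open>i \<in> {1..N}\<close>]) (rule bspec[OF elim])
    qed
  qed
qed

end
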